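(* Let $k$ and $n$ be positive integers with $k\le n/2$ and let $G\le S_n$. If $G$ is $k$-homogeneous and possesses the strong $k$-ut property, then for any rank $k$ map $t\in T_n$, the semigroup $\langle G,t\rangle\setminus G$ is idempotent generated.
   Context: Let $X=\{1,\ldots,n\}$; $S_n$ and $T_n$ are the symmetric group and full transformation monoid on $X$. The rank of a map is the size of its image. $\langle G,t\rangle$ is the semigroup generated by $G\cup\{t\}$; a semigroup is idempotent generated if every element is a product of its idempotents. $G$ is $k$-homogeneous if it is transitive on the $k$-element subsets of $X$. A set is a section (transversal) for a partition if it meets every part in exactly one point. A primitive group $G\le S_n$ has the strong $k$-ut property if, given any $(k+1)$-tuple $(a_1,\ldots,a_{k+1})$ of distinct elements of $X$ and any ordered partition $P=(A_1,\ldots,A_k)$ of $X$ into $k$ (nonempty) parts, there exists $g\in G$ such that $\{a_1,\ldots,a_k\}g$ is a section for $P$ and $a_1g,a_{k+1}g\in A_i$ for some $i\in\{1,\ldots,k\}$. *)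

theory Defs
  imports "HOL-Algebra.Sym_Groups" "HOL-Library.Disjoint_Sets"
begin

text \<open>
  Throughout, X is the set \<open>{1..n}\<close>. A map on X is represented by a function on \<open>nat\<close> that
  fixes every point outside X, so that permutations and transformations of X are composed
  by plain \<open>\<circ>\<close>. The right action \<open>a g\<close> is written \<open>g a\<close>; since \<open>\<circ>\<close> composes from right to
  left, products appear in the opposite order. This affects neither which sets of maps are
  groups or semigroups, nor generated semigroups, nor idempotents.
\<close>

definition full_transformations :: "nat \<Rightarrow> (nat \<Rightarrow> nat) set" where
  "full_transformations n = {f. f ` {1..n} \<subseteq> {1..n} \<and> (\<forall>x. x \<notin> {1..n} \<longrightarrow> f x = x)}"

definition map_rank :: "nat \<Rightarrow> (nat \<Rightarrow> nat) \<Rightarrow> nat" where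
  "map_rank n f = card (f ` {1..n})"

inductive_set semigroup_generated :: "('a \<Rightarrow> 'a) set \<Rightarrow> ('a \<Rightarrow> 'a) set"
  for A :: "('a \<Rightarrow> 'a) set" where
  incl: "f \<in> A \<Longrightarrow> f \<in> semigroup_generated A"
| comp: "f \<in> semigroup_generated A \<Longrightarrow> g \<in> semigroup_generated A \<Longrightarrow> f \<circ> g \<in> semigroup_generated A"

definition idempotents :: "('a \<Rightarrow> 'a) set \<Rightarrow> ('a \<Rightarrow> 'a) set" where
  "idempotents S = {e \<in> S. e \<circ> e = e}"

text \<open>The first conjunct says that S is a semigroup under composition.\<close>

definition idempotent_generated :: "('a \<Rightarrow> 'a) set \<Rightarrow> bool" where
  "idempotent_generated S \<longleftrightarrow>
     (\<forall>f\<in>S. \<forall>g\<in>S. f \<circ> g \<in> S) \<and>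
     (\<forall>f\<in>S. f \<in> semigroup_generated (idempotents S))"

definition homogeneous :: "nat \<Rightarrow> nat \<Rightarrow> (nat \<Rightarrow> nat) set \<Rightarrow> bool" where
  "homogeneous k n G \<longleftrightarrow>
     (\<forall>A B. A \<subseteq> {1..n} \<and> card A = k \<and> B \<subseteq> {1..n} \<and> card B = k \<longrightarrow> (\<exists>g\<in>G. g ` A = B))"

definition primitive :: "nat \<Rightarrow> (nat \<Rightarrow> nat) set \<Rightarrow> bool" where
  "primitive n G \<longleftrightarrow>
     (\<forall>x\<in>{1..n}. \<forall>y\<in>{1..n}. \<exists>g\<in>G. g x = y) \<and>
     (\<forall>P. partition_on {1..n} P \<and> (\<forall>g\<in>G. \<forall>B\<in>P. g ` B \<in> P) \<longrightarrow>
        P = {{1..n}} \<or> P = {{x} | x. x \<in> {1..n}})"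

definition section_for :: "'a set \<Rightarrow> 'a set set \<Rightarrow> bool" where
  "section_for S P \<longleftrightarrow> (\<forall>B\<in>P. \<exists>!x. x \<in> S \<inter> B)"

definition ordered_partition :: "nat \<Rightarrow> 'a set \<Rightarrow> (nat \<Rightarrow> 'a set) \<Rightarrow> bool" where
  "ordered_partition k X A \<longleftrightarrow>
     (\<forall>i\<in>{1..k}. A i \<noteq> {}) \<and> disjoint_family_on A {1..k} \<and> (\<Union>i\<in>{1..k}. A i) = X"

text \<open>
  Tuples of points and of parts are given by the values of \<open>a\<close> and \<open>A\<close> on \<open>{1..k + 1}\<close> and
  \<open>{1..k}\<close>; other values are irrelevant. The property is only defined for primitive groups,
  so primitivity is part of it.
\<close>

definition strong_ut :: "nat \<Rightarrow> nat \<Rightarrow> (nat \<Rightarrow> nat) set \<Rightarrow> bool" where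
  "strong_ut k n G \<longleftrightarrow> primitive n G \<and>
     (\<forall>a A. inj_on a {1..k + 1} \<and> a ` {1..k + 1} \<subseteq> {1..n} \<and> ordered_partition k {1..n} A \<longrightarrow>
        (\<exists>g\<in>G. section_for (g ` a ` {1..k}) (A ` {1..k}) \<and>
               (\<exists>i\<in>{1..k}. g (a 1) \<in> A i \<and> g (a (k + 1)) \<in> A i)))"

end

theory Submission
  imports Defs
begin

text \<open>
  Put \<open>X = {1..n}\<close>. Every member of \<open>\<langle>G, t\<rangle>\<close> outside \<open>G\<close> is a product of maps \<open>g \<circ> t \<circ> h\<close> with
  \<open>g, h \<in> G\<close>. Such a map again has rank \<open>k\<close>, and together with \<open>G\<close> it generates a subsemigroup of
  \<open>\<langle>G, t\<rangle>\<close>; so it is enough to write \<open>t\<close> itself as a product of idempotents of \<open>\<langle>G, t\<rangle>\<close> of rank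
  \<open>k\<close>.

  Homogeneity supplies the idempotents. If \<open>J\<close> is a transversal of the kernel classes of \<open>t\<close>, some
  \<open>g \<in> G\<close> sends the image of \<open>t\<close> onto \<open>J\<close>. Then \<open>g \<circ> t\<close> permutes \<open>J\<close>, and a suitable power of it is
  the idempotent that collapses each kernel class to its representative in \<open>J\<close>
  (\<open>collapse_in_singular_part\<close>).

  The strong ut property turns these idempotents into elementary moves. For a \<open>k\<close>-set \<open>J\<close>, a point
  \<open>a \<in> J\<close> and a point \<open>c \<notin> J\<close>, some \<open>G\<close>-translate of the kernel of \<open>t\<close> has \<open>J\<close> as a transversal and
  has \<open>a\<close> and \<open>c\<close> in one class. Collapsing this kernel onto \<open>(J - {a}) \<union> {c}\<close> carries \<open>a\<close> to \<open>c\<close> and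
  fixes the rest of \<open>J\<close> (\<open>exists_idempotent_move\<close>).

  Since \<open>k < n\<close>, there is always a vacant point, and so a sequence of such moves carries any injective
  \<open>k\<close>-tuple to any other one (\<open>moves_connect_injections\<close>), just as tokens are rearranged with the
  help of an empty square. Hence \<open>t\<close> factors as follows: collapse its kernel classes onto a
  transversal \<open>J\<close>, then move each \<open>j \<in> J\<close> to \<open>t j\<close>.
\<close>

section \<open>Generated semigroups and powers\<close>

lemma semigroup_generated_mono:
  assumes "A \<subseteq> semigroup_generated B"
  shows "semigroup_generated A \<subseteq> semigroup_generated B"
proof
  fix f assume "f \<in> semigroup_generated A"
  then show "f \<in> semigroup_generated B"
    by induction (use assms semigroup_generated.comp in blast)+
qed

lemma semigroup_generated_funpow:
  assumes "u \<in> semigroup_generated A" "0 < m"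
  shows "u ^^ m \<in> semigroup_generated A"
  using assms(2)
proof (induction m)
  case (Suc m)
  show ?case
  proof (cases "m = 0")
    case False
    then show ?thesis
      using semigroup_generated.comp[OF assms(1) Suc.IH] unfolding funpow.simps(2) by blast
  qed (use assms(1) in simp)
qed simp

text \<open>
  In a word in \<open>G \<union> {t}\<close> each letter from \<open>G\<close> can be absorbed into a neighbouring \<open>t\<close>, unless there is
  no \<open>t\<close> at all.
\<close>

lemma semigroup_generated_insert_cases:
  assumes G: "\<And>g h. g \<in> G \<Longrightarrow> h \<in> G \<Longrightarrow> g \<circ> h \<in> G" "id \<in> G"
    and f: "f \<in> semigroup_generated (insert t G)"
  shows "f \<in> G \<or> f \<in> semigroup_generated {g \<circ> t \<circ> h | g h. g \<in> G \<and> h \<in> G}"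
proof -
  define C where "C = {g \<circ> t \<circ> h | g h. g \<in> G \<and> h \<in> G}"
  have left: "g \<circ> w \<in> semigroup_generated C" if "g \<in> G" "w \<in> semigroup_generated C" for g w
    using that(2)
  proof induction
    case (incl w)
    then obtain g' h where "g' \<in> G" "h \<in> G" "w = g' \<circ> t \<circ> h"
      by (auto simp: C_def)
    then have "g \<circ> w = (g \<circ> g') \<circ> t \<circ> h" "g \<circ> g' \<in> G"
      using G that(1) by (auto simp: comp_assoc)
    then show ?case
      using \<open>h \<in> G\<close> unfolding C_def by (blast intro: semigroup_generated.incl)
  next
    case (comp w w')
    then show ?case
      by (metis comp_assoc semigroup_generated.comp)
  qed
  have right: "w \<circ> g \<in> semigroup_generated C" if "g \<in> G" "w \<in> semigroup_generated C" for g w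
    using that(2)
  proof induction
    case (incl w)
    then obtain g' h where "g' \<in> G" "h \<in> G" "w = g' \<circ> t \<circ> h"
      by (auto simp: C_def)
    then have "w \<circ> g = g' \<circ> t \<circ> (h \<circ> g)" "h \<circ> g \<in> G"
      using G that(1) by (auto simp: comp_assoc)
    then show ?case
      using \<open>g' \<in> G\<close> unfolding C_def by (blast intro: semigroup_generated.incl)
  next
    case (comp w w')
    then show ?case
      by (metis comp_assoc semigroup_generated.comp)
  qed
  have "t = id \<circ> t \<circ> id"
    by simp
  then have "t \<in> C"
    using G(2) unfolding C_def by blast
  from f have "f \<in> G \<or> f \<in> semigroup_generated C"
  proof induction
    case (incl f)
    then show ?case
      using \<open>t \<in> C\<close> by (auto intro: semigroup_generated.incl)
  next
    case (comp f g)
    then show ?case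
      using G left right by (blast intro: semigroup_generated.comp)
  qed
  then show ?thesis
    unfolding C_def .
qed

lemma bij_betw_funpow_id:
  assumes "finite J" "bij_betw u J J"
  shows "\<exists>m>0. \<forall>x\<in>J. (u ^^ m) x = x"
proof -
  define p where "p x = (if x \<in> J then u x else x)" for x
  have "bij_betw p J J"
    using assms(2) by (simp add: p_def cong: bij_betw_cong)
  then have "p permutes J"
    by (rule bij_imp_permutes) (simp add: p_def)
  then have "permutation p"
    using assms(1) permutation_permutes by blast
  then obtain m where m: "p ^^ m = id" "m > 0"
    using permutation_is_nilpotent by blast
  have "(u ^^ l) x = (p ^^ l) x \<and> (p ^^ l) x \<in> J" if "x \<in> J" for l x
    using that assms(2) by (induction l) (auto simp: p_def bij_betw_def)
  with m show ?thesis
    by (metis id_apply)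
qed

section \<open>Moving tokens with a vacant point\<close>

text \<open>
  The maps in \<open>M\<close> can move any single token to any vacant point while the other tokens stay put, and
  \<open>p\<close> and \<open>q\<close> are two placements of tokens labelled by \<open>I\<close>. The proof is by
  induction on the number of tokens still out of place. To put \<open>x\<close> in place when its target \<open>q x\<close> is
  occupied, by \<open>y\<close> say, first send \<open>y\<close> to a vacant point. The token \<open>y\<close> was itself out of place, so
  nothing is lost by that.
\<close>

lemma moves_connect_injections:
  fixes p q :: "'i \<Rightarrow> 'a" and M :: "('a \<Rightarrow> 'a) set"
  assumes M: "id \<in> M" "\<And>f g. f \<in> M \<Longrightarrow> g \<in> M \<Longrightarrow> f \<circ> g \<in> M"
    and move: "\<And>J a c. J \<subseteq> X \<Longrightarrow> card J = card I \<Longrightarrow> a \<in> J \<Longrightarrow> c \<in> X - J \<Longrightarrow>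
      \<exists>e\<in>M. e a = c \<and> (\<forall>x\<in>J - {a}. e x = x)"
    and I: "finite I" "card I < card X" and X: "finite X"
    and p: "inj_on p I" "p ` I \<subseteq> X" and q: "inj_on q I" "q ` I \<subseteq> X"
  shows "\<exists>m\<in>M. \<forall>x\<in>I. m (p x) = q x"
  using p
proof (induction "card {x\<in>I. p x \<noteq> q x}" arbitrary: p rule: less_induct)
  case (less p)
  have shift: "\<exists>e\<in>M. \<forall>z\<in>I. e (r z) = (r(x := c)) z"
    if r: "inj_on r I" "r ` I \<subseteq> X" and x: "x \<in> I" and c: "c \<in> X - r ` I" for r x c
  proof -
    obtain e where "e \<in> M" "e (r x) = c" "\<forall>y\<in>r ` I - {r x}. e y = y"
      using move[of "r ` I" "r x" c] r x c by (auto simp: card_image)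
    then show ?thesis
      using r(1) x by (intro bexI[of _ e]) (auto simp: inj_on_def)
  qed
  show ?case
  proof (cases "\<exists>x\<in>I. p x \<noteq> q x")
    case False
    then show ?thesis
      using M(1) by (intro bexI[of _ id]) auto
  next
    case True
    then obtain x where x: "x \<in> I" "p x \<noteq> q x"
      by blast
    have finish: ?thesis
      if e: "e \<in> M" "\<forall>z\<in>I. e (p z) = r z" and r: "inj_on r I" "r ` I \<subseteq> X"
        and sub: "{z\<in>I. r z \<noteq> q z} \<subseteq> {z\<in>I. p z \<noteq> q z} - {x}" for e r
    proof -
      have "{z\<in>I. r z \<noteq> q z} \<subset> {z\<in>I. p z \<noteq> q z}"
        using sub x by blast
      then have "card {z\<in>I. r z \<noteq> q z} < card {z\<in>I. p z \<noteq> q z}"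
        using I(1) by (intro psubset_card_mono) auto
      from less.hyps[OF this r] obtain m where "m \<in> M" "\<forall>z\<in>I. m (r z) = q z"
        by blast
      then show ?thesis
        using e M(2) by (intro bexI[of _ "m \<circ> e"]) auto
    qed
    show ?thesis
    proof (cases "q x \<in> p ` I")
      case False
      then have c: "q x \<in> X - p ` I"
        using q x by auto
      obtain e where e: "e \<in> M" "\<forall>z\<in>I. e (p z) = (p(x := q x)) z"
        using shift[OF less.prems x(1) c] by blast
      show ?thesis
      proof (rule finish[OF e])
        show "inj_on (p(x := q x)) I"
          using less.prems(1) c by (intro inj_on_fun_updI) auto
        show "(p(x := q x)) ` I \<subseteq> X"
          using less.prems(2) c by auto
      qed auto
    next
      case True
      then obtain y where y: "y \<in> I" "p y = q x"
        by force
      have "y \<noteq> x" "p y \<noteq> q y"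
        using x y q(1) by (auto dest: inj_onD)
      have "card (p ` I) < card X"
        using less.prems(1) I(2) by (simp add: card_image)
      then obtain c where c: "c \<in> X - p ` I"
        using X I(1) card_mono[of "p ` I" X] by (metis DiffI finite_imageI leD subsetI)
      obtain e where e: "e \<in> M" "\<forall>z\<in>I. e (p z) = (p(y := c)) z"
        using shift[OF less.prems y(1) c] by blast
      have p': "inj_on (p(y := c)) I"
        using less.prems(1) c by (intro inj_on_fun_updI) auto
      have p'X: "(p(y := c)) ` I \<subseteq> X"
        using less.prems(2) c by auto
      have "q x \<noteq> c"
        using True c by auto
      moreover have "q x \<noteq> p z" if "z \<in> I" "z \<noteq> y" for z
        using inj_onD[OF less.prems(1), of z y] y that by auto
      ultimately have "q x \<noteq> (p(y := c)) z" if "z \<in> I" for z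
        using that by (cases "z = y") auto
      then have free: "q x \<in> X - (p(y := c)) ` I"
        using q(2) x(1) by blast
      obtain e' where e': "e' \<in> M"
          "\<forall>z\<in>I. e' ((p(y := c)) z) = (p(y := c, x := q x)) z"
        using shift[OF p' p'X x(1) free] by blast
      show ?thesis
      proof (rule finish[of "e' \<circ> e" "p(y := c, x := q x)"])
        show "e' \<circ> e \<in> M"
          using M(2) e e' by blast
        show "\<forall>z\<in>I. (e' \<circ> e) (p z) = (p(y := c, x := q x)) z"
          using e(2) e'(2) by simp
        show "inj_on (p(y := c, x := q x)) I"
          using inj_on_fun_updI[OF p'] free by blast
        show "(p(y := c, x := q x)) ` I \<subseteq> X"
          using p'X free by auto
        show "{z\<in>I. (p(y := c, x := q x)) z \<noteq> q z} \<subseteq> {z\<in>I. p z \<noteq> q z} - {x}"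
          using \<open>p y \<noteq> q y\<close> by auto
      qed
    qed
  qed
qed

section \<open>The part of the generated semigroup outside the group\<close>

text \<open>
  The assumptions are bundled so that they can be instantiated a second time with \<open>g \<circ> t \<circ> h\<close> in the
  place of \<open>t\<close>. The inequality \<open>k < n\<close> is what makes maps of rank \<open>k\<close> non-injective and leaves a point
  vacant outside every \<open>k\<close>-set.
\<close>

locale homogeneous_ut_group =
  fixes k n :: nat and G :: "(nat \<Rightarrow> nat) set" and t :: "nat \<Rightarrow> nat"
  assumes k_pos: "0 < k" and k_less: "k < n"
    and subgroup_G: "subgroup G (sym_group n)"
    and homogeneous_G: "homogeneous k n G"
    and strong_ut_G: "strong_ut k n G"
    and t_trans: "t \<in> full_transformations n"
    and rank_t: "map_rank n t = k"
begin

abbreviation X :: "nat set" where "X \<equiv> {1..n}"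

definition singular_part :: "(nat \<Rightarrow> nat) set" where
  "singular_part = semigroup_generated (insert t G) - G"

lemma G_permutes: "g \<in> G \<Longrightarrow> g permutes X"
  using subgroup.subset[OF subgroup_G] by (auto simp: sym_group_def)

lemma G_comp: "g \<in> G \<Longrightarrow> h \<in> G \<Longrightarrow> g \<circ> h \<in> G"
  using subgroup.m_closed[OF subgroup_G] by (simp add: sym_group_def)

lemma G_id: "id \<in> G"
  using subgroup.one_closed[OF subgroup_G] by (simp add: sym_group_def)

lemma G_inv: "g \<in> G \<Longrightarrow> inv' g \<in> G"
  using subgroup.m_inv_closed[OF subgroup_G] subgroup.subset[OF subgroup_G]
  by (metis subsetD sym_group_inv_equality)

lemma t_closed: "x \<in> X \<Longrightarrow> t x \<in> X" and t_outside: "x \<notin> X \<Longrightarrow> t x = x"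
  using t_trans unfolding full_transformations_def by blast+

lemma G_generated: "g \<in> G \<Longrightarrow> g \<in> semigroup_generated (insert t G)"
  and t_generated: "t \<in> semigroup_generated (insert t G)"
  by (auto intro: semigroup_generated.incl)

lemma card_image_t: "card (t ` X) = k"
  using rank_t by (simp add: map_rank_def)

lemma not_inj_on_t: "\<not> inj_on t X"
  using card_image_t card_image[of t X] k_less by auto

lemma generated_cases:
  assumes "f \<in> semigroup_generated (insert t G)"
  shows "f \<in> G \<or> f \<in> semigroup_generated {g \<circ> t \<circ> h | g h. g \<in> G \<and> h \<in> G}"
  using semigroup_generated_insert_cases assms G_comp G_id by blast

lemma generated_closed:
  assumes "f \<in> semigroup_generated (insert t G)" "x \<in> X"
  shows "f x \<in> X"
  using assms
proof (induction arbitrary: x)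
  case (incl f)
  then show ?case
    using t_closed G_permutes permutes_in_image by (metis insert_iff)
qed auto

lemma generated_outside:
  assumes "f \<in> semigroup_generated (insert t G)" "x \<notin> X"
  shows "f x = x"
  using assms
proof (induction arbitrary: x)
  case (incl f)
  then show ?case
    using t_outside G_permutes permutes_not_in by (metis insert_iff)
qed auto

lemma not_inj_on_triple_product:
  assumes "g \<in> G" "h \<in> G"
  shows "\<not> inj_on (g \<circ> t \<circ> h) X"
proof
  assume "inj_on (g \<circ> t \<circ> h) X"
  then have "inj_on (g \<circ> t) (h ` X)"
    using G_permutes[OF assms(2)] by (simp add: inj_on_imageI)
  then show False
    using not_inj_on_t G_permutes[OF assms(2)]
    by (simp add: permutes_image inj_on_imageI2)
qed

text \<open>
  Inside the generated semigroup, membership in \<open>G\<close> is the same as injectivity on \<open>X\<close>, which is easy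
  to control in products: a word containing \<open>t\<close> is never injective.
\<close>

lemma singular_part_iff:
  "f \<in> singular_part \<longleftrightarrow> f \<in> semigroup_generated (insert t G) \<and> \<not> inj_on f X"
proof -
  have "\<not> inj_on f X" if "f \<in> semigroup_generated {g \<circ> t \<circ> h | g h. g \<in> G \<and> h \<in> G}" for f
    using that
  proof induction
    case (incl f)
    then show ?case
      using not_inj_on_triple_product by blast
  next
    case (comp f g)
    then show ?case
      using inj_on_imageI2 by blast
  qed
  moreover have "inj_on f X" if "f \<in> G" for f
    using G_permutes[OF that] by (meson permutes_inj_on)
  ultimately show ?thesis
    using generated_cases unfolding singular_part_def by blast
qed

lemma triple_product_in_singular_part:
  assumes "g \<in> G" "h \<in> G"
  shows "g \<circ> t \<circ> h \<in> singular_part"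
  using assms not_inj_on_triple_product G_generated t_generated unfolding singular_part_iff
  by (blast intro: semigroup_generated.comp)

lemma singular_part_comp:
  assumes "f \<in> singular_part" "g \<in> singular_part"
  shows "f \<circ> g \<in> singular_part"
  using assms unfolding singular_part_iff
  by (auto intro: semigroup_generated.comp dest: inj_on_imageI2)

section \<open>Collapsing kernel classes onto a transversal\<close>

definition collapse :: "nat set \<Rightarrow> nat \<Rightarrow> nat" where
  "collapse J x = (if x \<in> X then the_inv_into J t (t x) else x)"

context
  fixes J :: "nat set"
  assumes J: "J \<subseteq> X" "card J = k" "inj_on t J"
begin

lemma image_transversal: "t ` J = t ` X"
  using J card_image_t by (intro card_subset_eq) (auto simp: card_image)

lemma collapse_mem: "x \<in> X \<Longrightarrow> collapse J x \<in> J"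
  and t_collapse: "x \<in> X \<Longrightarrow> t (collapse J x) = t x"
  using the_inv_into_into[OF J(3), of "t x" J] f_the_inv_into_f[OF J(3), of "t x"] image_transversal
  by (auto simp: collapse_def)

lemma collapse_eqI: "x \<in> X \<Longrightarrow> j \<in> J \<Longrightarrow> t j = t x \<Longrightarrow> collapse J x = j"
  using collapse_mem t_collapse J(3) by (metis inj_onD)

lemma collapse_idem: "collapse J \<circ> collapse J = collapse J"
proof
  fix x
  show "(collapse J \<circ> collapse J) x = collapse J x"
  proof (cases "x \<in> X")
    case True
    then show ?thesis
      using collapse_mem[OF True] J(1) collapse_eqI by auto
  qed (auto simp: collapse_def)
qed

text \<open>
  Choose \<open>g \<in> G\<close> carrying the image of \<open>t\<close> onto \<open>J\<close>. Then \<open>u = g \<circ> t\<close> has the kernel of \<open>t\<close> and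
  permutes \<open>J\<close>, so that a power of \<open>u\<close> that is the identity on \<open>J\<close> is the collapse onto \<open>J\<close>.
\<close>

lemma collapse_in_singular_part: "collapse J \<in> singular_part"
proof -
  have "t ` X \<subseteq> X"
    using t_closed by auto
  then obtain g where g: "g \<in> G" "g ` t ` X = J"
    using homogeneous_G J card_image_t unfolding homogeneous_def by metis
  define u where "u = g \<circ> t"
  have "finite J"
    using J(1) finite_subset by blast
  have "u ` J = J"
    unfolding u_def image_comp[symmetric] image_transversal g(2) ..
  then have "bij_betw u J J"
    using \<open>finite J\<close> by (simp add: bij_betw_def eq_card_imp_inj_on)
  then obtain m where m: "m > 0" "\<forall>x\<in>J. (u ^^ m) x = x"
    using bij_betw_funpow_id \<open>finite J\<close> by blast
  have gen: "u \<in> semigroup_generated (insert t G)"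
    unfolding u_def using G_generated[OF g(1)] t_generated by (rule semigroup_generated.comp)
  have pow: "u ^^ m \<in> semigroup_generated (insert t G)"
    using semigroup_generated_funpow[OF gen m(1)] .
  have "(u ^^ m) x = collapse J x" for x
  proof (cases "x \<in> X")
    case True
    obtain l where l: "m = Suc l"
      using m(1) gr0_implies_Suc by blast
    have "u x = u (collapse J x)"
      using t_collapse[OF True] by (simp add: u_def)
    then have "(u ^^ m) x = (u ^^ m) (collapse J x)"
      by (simp add: l funpow_Suc_right del: funpow.simps)
    then show ?thesis
      using m(2) collapse_mem[OF True] by simp
  next
    case False
    then show ?thesis
      using generated_outside[OF pow False] unfolding collapse_def if_not_P[OF False] by blast
  qed
  then have eq: "u ^^ m = collapse J"
    by blast
  have "\<not> inj_on (collapse J) X"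
  proof
    assume "inj_on (collapse J) X"
    then have "card X \<le> card J"
      using \<open>finite J\<close> collapse_mem by (intro card_inj_on_le) auto
    then show False
      using J(2) k_less by simp
  qed
  then show ?thesis
    using pow eq by (simp add: singular_part_iff)
qed

end

section \<open>Moving one point by an idempotent\<close>

lemma conjugate_idempotent:
  assumes e: "e \<in> idempotents singular_part" and g: "g \<in> G"
  shows "inv' g \<circ> e \<circ> g \<in> idempotents singular_part"
proof -
  note perm = G_permutes[OF g]
  have "(inv' g \<circ> e \<circ> g) \<circ> (inv' g \<circ> e \<circ> g) = inv' g \<circ> e \<circ> g"
    using e permutes_inverses[OF perm]
    by (auto simp: idempotents_def fun_eq_iff)
  moreover have "inv' g \<circ> e \<circ> g \<in> semigroup_generated (insert t G)"
    using e G_generated[OF g] G_generated[OF G_inv[OF g]]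
    by (auto simp: idempotents_def singular_part_iff intro: semigroup_generated.comp)
  moreover have "\<not> inj_on (inv' g \<circ> e \<circ> g) X"
  proof
    assume "inj_on (inv' g \<circ> e \<circ> g) X"
    then have "inj_on (inv' g \<circ> e) (g ` X)"
      by (simp add: inj_on_imageI)
    then have "inj_on e X"
      using perm by (simp add: permutes_image inj_on_imageI2)
    then show False
      using e by (simp add: idempotents_def singular_part_iff)
  qed
  ultimately show ?thesis
    by (simp add: idempotents_def singular_part_iff)
qed

text \<open>
  This is the strong ut property read for the kernel partition of \<open>t\<close>: the tuple lists \<open>J\<close> with \<open>a\<close>
  first, followed by \<open>c\<close>.
\<close>

lemma exists_transversal_translate:
  assumes J: "J \<subseteq> X" "card J = k" and a: "a \<in> J" and c: "c \<in> X - J"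
  shows "\<exists>g\<in>G. inj_on t (g ` J) \<and> t (g a) = t (g c)"
proof -
  have "finite J"
    using J(1) finite_subset by blast
  have "card {2..k} = card (J - {a})"
    using J a \<open>finite J\<close> by simp
  then obtain b where b: "bij_betw b {2..k} (J - {a})"
    using finite_same_card_bij[of "{2..k}" "J - {a}"] \<open>finite J\<close> by auto
  define s where "s = b(1 := a, k + 1 := c)"
  have s1: "s 1 = a" and sk: "s (k + 1) = c"
    using k_pos by (auto simp: s_def)
  have "{1..k} = insert 1 {2..k}"
    using k_pos by auto
  moreover have "s ` {2..k} = b ` {2..k}"
    by (auto simp: s_def)
  ultimately have sJ: "s ` {1..k} = J"
    using s1 b a by (auto simp: bij_betw_def)
  then have inj: "inj_on s {1..k}"
    using J(2) by (intro eq_card_imp_inj_on) auto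
  have Suc: "{1..k + 1} = insert (k + 1) {1..k}"
    by auto
  have inj': "inj_on s {1..k + 1}"
    unfolding Suc using inj sJ sk c by auto
  have sX: "s ` {1..k + 1} \<subseteq> X"
    unfolding Suc using sJ sk c J(1) by auto
  obtain h where h: "bij_betw h {1..k} (t ` X)"
    using finite_same_card_bij[of "{1..k}" "t ` X"] card_image_t by auto
  define A where "A i = {x \<in> X. t x = h i}" for i
  have "ordered_partition k X A"
    unfolding ordered_partition_def
  proof (intro conjI ballI)
    show "A i \<noteq> {}" if "i \<in> {1..k}" for i
    proof -
      have "h i \<in> t ` X"
        using bij_betwE[OF h] that by blast
      then obtain x where "x \<in> X" "h i = t x"
        by (rule imageE)
      then have "x \<in> A i"
        by (simp add: A_def)
      then show ?thesis
        by blast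
    qed
    show "disjoint_family_on A {1..k}"
      using inj_onD[OF bij_betw_imp_inj_on[OF h]]
      unfolding disjoint_family_on_def A_def by force
    show "\<Union> (A ` {1..k}) = X"
    proof (intro equalityI subsetI)
      fix x assume "x \<in> X"
      then have "t x \<in> h ` {1..k}"
        using bij_betw_imp_surj_on[OF h] by blast
      then show "x \<in> \<Union> (A ` {1..k})"
        using \<open>x \<in> X\<close> unfolding A_def by blast
    qed (auto simp: A_def)
  qed
  then obtain g where g: "g \<in> G" and sec: "section_for (g ` s ` {1..k}) (A ` {1..k})"
    and same: "\<exists>i\<in>{1..k}. g (s 1) \<in> A i \<and> g (s (k + 1)) \<in> A i"
    using strong_ut_G inj' sX unfolding strong_ut_def by blast
  have "inj_on t (g ` J)"
  proof (rule inj_onI)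
    fix x y assume xy: "x \<in> g ` J" "y \<in> g ` J" "t x = t y"
    have "g ` J \<subseteq> X"
      using G_permutes[OF g] J(1) permutes_image by blast
    with xy have xyX: "x \<in> X" "y \<in> X"
      by blast+
    obtain i where i: "i \<in> {1..k}" "t x = h i"
      using h xyX(1) unfolding bij_betw_def by (metis imageE imageI)
    then have "x \<in> g ` J \<inter> A i" "y \<in> g ` J \<inter> A i"
      using xy xyX by (auto simp: A_def)
    then show "x = y"
      using sec i(1) unfolding sJ section_for_def by blast
  qed
  moreover have "t (g a) = t (g c)"
    using same unfolding s1 sk by (auto simp: A_def)
  ultimately show ?thesis
    using g by blast
qed

text \<open>
  After translating by \<open>g\<close>, the points \<open>a\<close> and \<open>c\<close> share a kernel class of \<open>t\<close>. So one collapses onto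
  the translate of \<open>(J - {a}) \<union> {c}\<close> and conjugates back.
\<close>

lemma exists_idempotent_move:
  assumes J: "J \<subseteq> X" "card J = k" and a: "a \<in> J" and c: "c \<in> X - J"
  shows "\<exists>e\<in>idempotents singular_part. e a = c \<and> (\<forall>x\<in>J - {a}. e x = x)"
proof -
  obtain g where g: "g \<in> G" and inj: "inj_on t (g ` J)" and same: "t (g a) = t (g c)"
    using exists_transversal_translate[OF assms] by blast
  note perm = G_permutes[OF g]
  have inj_g: "inj g"
    using perm permutes_inj by blast
  have fin: "finite J"
    using J(1) finite_subset by blast
  define J' where "J' = g ` insert c (J - {a})"
  have "card J' = card (insert c (J - {a}))"
    unfolding J'_def using inj_g by (intro card_image) (simp add: inj_on_def)
  also have "\<dots> = k"
    using J a c fin k_pos by (simp add: card_insert_if)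
  finally have cardJ': "card J' = k" .
  have "insert c (J - {a}) \<subseteq> X"
    using J c by auto
  then have J'X: "J' \<subseteq> X"
    unfolding J'_def using permutes_image[OF perm] by blast
  \<comment> \<open>Replacing a representative by another point of its kernel class preserves transversality.\<close>
  have injJ': "inj_on t J'"
  proof -
    have "t (g c) \<notin> t ` g ` (J - {a})"
    proof
      assume "t (g c) \<in> t ` g ` (J - {a})"
      then obtain x where x: "x \<in> J" "x \<noteq> a" "t (g a) = t (g x)"
        using same by auto
      then have "g a = g x"
        using inj a by (auto dest: inj_onD)
      then show False
        using inj_g x(2) by (auto dest: injD)
    qed
    moreover have "inj_on t (g ` (J - {a}))"
      using inj by (rule inj_on_subset) auto
    ultimately show ?thesis
      unfolding J'_def by auto
  qed
  have idem: "collapse J' \<in> idempotents singular_part"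
    using collapse_in_singular_part[OF J'X cardJ' injJ'] collapse_idem[OF J'X cardJ' injJ']
    by (simp add: idempotents_def)
  have gX: "g x \<in> X" if "x \<in> X" for x
    using that perm permutes_in_image by metis
  have "collapse J' (g a) = g c"
    using a J(1) gX same by (intro collapse_eqI[OF J'X cardJ' injJ']) (auto simp: J'_def)
  moreover have "collapse J' (g x) = g x" if "x \<in> J - {a}" for x
    using that J(1) gX by (intro collapse_eqI[OF J'X cardJ' injJ']) (auto simp: J'_def)
  ultimately show ?thesis
    using conjugate_idempotent[OF idem g] permutes_inverses[OF perm]
    by (intro bexI[of _ "inv' g \<circ> collapse J' \<circ> g"]) auto
qed

section \<open>Factorization into idempotents\<close>

lemma t_product_of_idempotents: "t \<in> semigroup_generated (idempotents singular_part)"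
proof -
  obtain J where J: "J \<subseteq> X" "inj_on t J" "t ` J = t ` X"
    using subset_image_inj[of "t ` X" t X] by auto
  then have cardJ: "card J = k"
    using card_image_t card_image by metis
  \<comment> \<open>The identity is adjoined because no move at all is made when \<open>t\<close> fixes \<open>J\<close> pointwise.\<close>
  define M where "M = insert id (semigroup_generated (idempotents singular_part))"
  have "\<exists>m\<in>M. \<forall>x\<in>J. m (id x) = t x"
  proof (rule moves_connect_injections[where X = X])
    show "f \<circ> g \<in> M" if "f \<in> M" "g \<in> M" for f g
      using that by (auto simp: M_def intro: semigroup_generated.comp)
    show "\<exists>e\<in>M. e a = c \<and> (\<forall>x\<in>J' - {a}. e x = x)"
      if "J' \<subseteq> X" "card J' = card J" "a \<in> J'" "c \<in> X - J'" for J' a c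
      using exists_idempotent_move[of J' a c] that cardJ
      by (auto simp: M_def intro: semigroup_generated.incl)
    show "finite J"
      using J(1) finite_subset by blast
    show "card J < card X"
      using cardJ k_less by simp
    show "t ` J \<subseteq> X"
      using J(1) t_closed by auto
  qed (use J in \<open>auto simp: M_def\<close>)
  then obtain m where m: "m \<in> M" "\<forall>x\<in>J. m x = t x"
    by auto
  have col: "collapse J \<in> idempotents singular_part"
    using collapse_in_singular_part[OF J(1) cardJ J(2)] collapse_idem[OF J(1) cardJ J(2)]
    by (simp add: idempotents_def)
  then have prod: "m \<circ> collapse J \<in> semigroup_generated (idempotents singular_part)"
    using m(1) by (auto simp: M_def intro: semigroup_generated.intros)
  have "idempotents singular_part \<subseteq> semigroup_generated (insert t G)"
    by (auto simp: idempotents_def singular_part_def)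
  then have prod': "m \<circ> collapse J \<in> semigroup_generated (insert t G)"
    using prod semigroup_generated_mono by blast
  have "(m \<circ> collapse J) x = t x" for x
  proof (cases "x \<in> X")
    case True
    then show ?thesis
      using m(2) collapse_mem[OF J(1) cardJ J(2) True] t_collapse[OF J(1) cardJ J(2) True] by simp
  next
    case False
    then show ?thesis
      using generated_outside[OF prod' False] t_outside by simp
  qed
  then have "m \<circ> collapse J = t"
    by blast
  with prod show ?thesis
    by simp
qed

lemma triple_product_locale:
  assumes "g \<in> G" "h \<in> G"
  shows "homogeneous_ut_group k n G (g \<circ> t \<circ> h)"
proof (rule homogeneous_ut_group.intro)
  have gen: "g \<circ> t \<circ> h \<in> semigroup_generated (insert t G)"
    using triple_product_in_singular_part[OF assms] by (simp add: singular_part_def)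
  show "g \<circ> t \<circ> h \<in> full_transformations n"
    unfolding full_transformations_def using generated_closed[OF gen] generated_outside[OF gen]
    by blast
  have "(g \<circ> t \<circ> h) ` X = g ` t ` X"
    unfolding image_comp[symmetric] permutes_image[OF G_permutes[OF assms(2)]] ..
  moreover have "inj_on g (t ` X)"
    using G_permutes[OF assms(1)] by (meson permutes_inj_on)
  ultimately show "map_rank n (g \<circ> t \<circ> h) = k"
    unfolding map_rank_def by (metis card_image card_image_t)
qed (use k_pos k_less subgroup_G homogeneous_G strong_ut_G in auto)

text \<open>
  The factorization of \<open>t\<close> is applied to \<open>g \<circ> t \<circ> h\<close> in the role of \<open>t\<close>, and the idempotents so obtained
  already lie in the semigroup of \<open>t\<close>.
\<close>

lemma triple_product_of_idempotents:
  assumes "g \<in> G" "h \<in> G"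
  shows "g \<circ> t \<circ> h \<in> semigroup_generated (idempotents singular_part)"
proof -
  interpret T: homogeneous_ut_group k n G "g \<circ> t \<circ> h"
    using triple_product_locale[OF assms] .
  have "insert (g \<circ> t \<circ> h) G \<subseteq> semigroup_generated (insert t G)"
    using triple_product_in_singular_part[OF assms]
    by (auto simp: singular_part_def intro: semigroup_generated.incl)
  then have "T.singular_part \<subseteq> singular_part"
    using semigroup_generated_mono unfolding T.singular_part_def singular_part_def by blast
  then have "idempotents T.singular_part \<subseteq> semigroup_generated (idempotents singular_part)"
    by (auto simp: idempotents_def intro: semigroup_generated.incl)
  then show ?thesis
    using T.t_product_of_idempotents semigroup_generated_mono by blast
qed

lemma idempotent_generated_singular_part: "idempotent_generated singular_part"
  unfolding idempotent_generated_def
proof (intro conjI ballI)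
  fix f assume "f \<in> singular_part"
  then have "f \<in> semigroup_generated {g \<circ> t \<circ> h | g h. g \<in> G \<and> h \<in> G}"
    using generated_cases by (auto simp: singular_part_def)
  then show "f \<in> semigroup_generated (idempotents singular_part)"
    using semigroup_generated_mono[of "{g \<circ> t \<circ> h | g h. g \<in> G \<and> h \<in> G}"]
      triple_product_of_idempotents by blast
qed (rule singular_part_comp)

end

theorem theorem3p1:
  fixes k n :: nat and G :: "(nat \<Rightarrow> nat) set" and t :: "nat \<Rightarrow> nat"
  assumes "k > 0" and "n > 0" and "2 * k \<le> n"
    and "subgroup G (sym_group n)"
    and "homogeneous k n G"
    and "strong_ut k n G"
    and "t \<in> full_transformations n" and "map_rank n t = k"
  shows "idempotent_generated (semigroup_generated (insert t G) - G)"
proof -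
  interpret homogeneous_ut_group k n G t
    using assms by (intro homogeneous_ut_group.intro) auto
  show ?thesis
    using idempotent_generated_singular_part unfolding singular_part_def .
qed

end
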